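(* Let $\lambda_1,\lambda_2,\ldots,\lambda_n$ be positive real numbers. Then the $n\times n$ matrix $\left[\frac{1}{\beta(\lambda_i,\lambda_j)}\right]_{i,j=1}^{n}$ is infinitely divisible.
   Context: Here $\beta(x,y)=\frac{\Gamma(x)\Gamma(y)}{\Gamma(x+y)}$ is the beta function. A complex $n\times n$ matrix $A$ is positive semidefinite if $x^*Ax\ge 0$ for all $x\in\mathbb C^n$. An $n\times n$ matrix $A=[a_{ij}]$ with $a_{ij}\ge 0$ is called infinitely divisible if the entrywise power $A^{\circ r}=[a_{ij}^r]$ is positive semidefinite for every real $r>0$. *)

theory Defs
  imports "HOL-Analysis.Analysis"
begin

text \<open>The quantity \<open>x\<^sup>* A x\<close> is complex; asking for membership in the set of nonnegative
  reals requires it to be real as well as nonnegative.\<close>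

definition positive_semidefinite :: "complex ^ 'n ^ 'n \<Rightarrow> bool" where
  "positive_semidefinite A \<longleftrightarrow>
     (\<forall>x :: complex ^ 'n. (\<Sum>i\<in>UNIV. cnj (x $ i) * (A *v x) $ i) \<in> \<real>\<^sub>\<ge>\<^sub>0)"

text \<open>For \<open>r > 0\<close> the library power satisfies \<open>0 powr r = 0\<close>, so \<open>powr\<close> is the usual power
  on all nonnegative entries.\<close>

definition entrywise_power :: "real ^ 'n ^ 'm \<Rightarrow> real \<Rightarrow> real ^ 'n ^ 'm" where
  "entrywise_power A r = (\<chi> i j. (A $ i $ j) powr r)"

definition infinitely_divisible :: "real ^ 'n ^ 'n \<Rightarrow> bool" where
  "infinitely_divisible A \<longleftrightarrow>
     (\<forall>i j. A $ i $ j \<ge> 0) \<and>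
     (\<forall>r > 0. positive_semidefinite (\<chi> i j. complex_of_real (entrywise_power A r $ i $ j)))"

end

theory Submission
  imports Defs
begin

text \<open>
  Since \<open>1 / Beta x y = \<Gamma>(x + y) / (\<Gamma>(x) \<Gamma>(y))\<close>, the \<open>r\<close>-th entrywise power is diagonally congruent to
  the matrix of the \<open>\<Gamma>(\<lambda>\<^sub>i + \<lambda>\<^sub>j)\<^sup>r\<close>, so it suffices to treat the latter. By Gauss's product formula
  \<open>\<Gamma>(x + y)\<^sup>r\<close> is the limit of \<open>(n!)\<^sup>r n\<^sup>r\<^sup>x n\<^sup>r\<^sup>y \<Prod>\<^sub>k\<^sub>\<le>\<^sub>n (x + y + k)\<^sup>-\<^sup>r\<close> as \<open>n\<close> tends to infinity,
  and the factors \<open>n\<^sup>r\<^sup>x n\<^sup>r\<^sup>y\<close> are once more a diagonal congruence. What remains is that entrywise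
  multiplication by the matrix of \<open>(a\<^sub>i + a\<^sub>j)\<^sup>-\<^sup>r\<close>, with \<open>a\<^sub>i = \<lambda>\<^sub>i + k/2 > 0\<close>, preserves positive
  semidefiniteness (\<open>psd_kernel_mult_Cauchy_powr\<close>).

  The Cayley transform \<open>u = (a - 1) / (a + 1)\<close> maps the positive half-line into \<open>(-1, 1)\<close> and gives
  \<open>a\<^sub>i + a\<^sub>j = (a\<^sub>i + 1) (a\<^sub>j + 1) (1 - u\<^sub>i u\<^sub>j) / 2\<close>. Up to a diagonal congruence the multiplier is
  therefore \<open>(1 - u\<^sub>i u\<^sub>j)\<^sup>-\<^sup>r\<close>, whose binomial series in \<open>u\<^sub>i u\<^sub>j\<close> has nonnegative coefficients: it is a
  nonnegative combination of the congruences by \<open>u\<^sup>n\<close>. Working with multipliers of this form avoids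
  the general Schur product theorem.
\<close>

section \<open>Positive semidefinite real kernels\<close>

definition psd_kernel :: "('n::finite \<Rightarrow> 'n \<Rightarrow> real) \<Rightarrow> bool" where
  "psd_kernel K \<longleftrightarrow>
     (\<forall>i j. K i j = K j i) \<and> (\<forall>c. 0 \<le> (\<Sum>i\<in>UNIV. \<Sum>j\<in>UNIV. c i * c j * K i j))"

lemma psd_kernel_const:
  assumes "0 \<le> s"
  shows "psd_kernel (\<lambda>i j. s)"
  unfolding psd_kernel_def
proof (intro conjI allI refl)
  fix c :: "'n \<Rightarrow> real"
  have "(\<Sum>i\<in>UNIV. \<Sum>j\<in>UNIV. c i * c j * s) = s * (\<Sum>i\<in>UNIV. c i)\<^sup>2"
    by (simp add: power2_eq_square sum_product sum_distrib_left mult_ac)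
  with assms show "0 \<le> (\<Sum>i\<in>UNIV. \<Sum>j\<in>UNIV. c i * c j * s)" by simp
qed

lemma psd_kernel_congruence:
  assumes "psd_kernel K"
  shows "psd_kernel (\<lambda>i j. d i * d j * K i j)"
  unfolding psd_kernel_def
proof (intro conjI allI)
  fix i j show "d i * d j * K i j = d j * d i * K j i"
    using assms by (simp add: psd_kernel_def)
next
  fix c
  have "0 \<le> (\<Sum>i\<in>UNIV. \<Sum>j\<in>UNIV. (c i * d i) * (c j * d j) * K i j)"
    using assms unfolding psd_kernel_def by (elim conjE allE[of _ "\<lambda>i. c i * d i"])
  then show "0 \<le> (\<Sum>i\<in>UNIV. \<Sum>j\<in>UNIV. c i * c j * (d i * d j * K i j))"
    by (simp add: mult_ac)
qed

lemma psd_kernel_scale: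
  assumes "psd_kernel K" "0 \<le> s"
  shows "psd_kernel (\<lambda>i j. s * K i j)"
  using psd_kernel_congruence[OF assms(1), of "\<lambda>_. sqrt s"] assms(2) by simp

lemma psd_kernel_sum:
  assumes "\<And>k. k \<in> A \<Longrightarrow> psd_kernel (K k)"
  shows "psd_kernel (\<lambda>i j. \<Sum>k\<in>A. K k i j)"
  unfolding psd_kernel_def
proof (intro conjI allI)
  fix i j show "(\<Sum>k\<in>A. K k i j) = (\<Sum>k\<in>A. K k j i)"
    using assms by (intro sum.cong refl) (simp add: psd_kernel_def)
next
  fix c
  have "(\<Sum>i\<in>UNIV. \<Sum>j\<in>UNIV. c i * c j * (\<Sum>k\<in>A. K k i j))
      = (\<Sum>i\<in>UNIV. \<Sum>k\<in>A. \<Sum>j\<in>UNIV. c i * c j * K k i j)"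
    by (subst (2) sum.swap) (simp add: sum_distrib_left)
  also have "\<dots> = (\<Sum>k\<in>A. \<Sum>i\<in>UNIV. \<Sum>j\<in>UNIV. c i * c j * K k i j)"
    by (rule sum.swap)
  also have "0 \<le> \<dots>"
    by (rule sum_nonneg) (use assms in \<open>simp add: psd_kernel_def\<close>)
  finally show "0 \<le> (\<Sum>i\<in>UNIV. \<Sum>j\<in>UNIV. c i * c j * (\<Sum>k\<in>A. K k i j))" .
qed

lemma psd_kernel_limit:
  assumes "\<And>n. psd_kernel (K n)" "\<And>i j. (\<lambda>n. K n i j) \<longlonglongrightarrow> L i j"
  shows "psd_kernel L"
  unfolding psd_kernel_def
proof (intro conjI allI)
  fix i j
  have "(\<lambda>n. K n i j) \<longlonglongrightarrow> L j i"
    using assms(1) assms(2)[of j i] by (simp add: psd_kernel_def)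
  with assms(2) show "L i j = L j i"
    by (rule LIMSEQ_unique)
next
  fix c
  have "(\<lambda>n. \<Sum>i\<in>UNIV. \<Sum>j\<in>UNIV. c i * c j * K n i j)
      \<longlonglongrightarrow> (\<Sum>i\<in>UNIV. \<Sum>j\<in>UNIV. c i * c j * L i j)"
    by (intro tendsto_intros assms(2))
  moreover have "0 \<le> (\<Sum>i\<in>UNIV. \<Sum>j\<in>UNIV. c i * c j * K n i j)" for n
    using assms(1) by (simp add: psd_kernel_def)
  ultimately show "0 \<le> (\<Sum>i\<in>UNIV. \<Sum>j\<in>UNIV. c i * c j * L i j)"
    by (intro LIMSEQ_le_const) auto
qed

text \<open>
  For a real symmetric kernel the Hermitian form at \<open>x\<close> is the sum of the real quadratic forms at
  \<open>Re x\<close> and \<open>Im x\<close>; by symmetry the cross terms cancel.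
\<close>

lemma psd_kernel_imp_positive_semidefinite:
  fixes K :: "'n::finite \<Rightarrow> 'n \<Rightarrow> real"
  assumes "psd_kernel K"
  shows "positive_semidefinite (\<chi> i j. complex_of_real (K i j))"
  unfolding positive_semidefinite_def
proof
  fix x :: "complex ^ 'n"
  define z where "z = (\<Sum>i\<in>UNIV. cnj (x $ i) * ((\<chi> i j. complex_of_real (K i j)) *v x) $ i)"
  have sym: "K i j = K j i" for i j
    using assms by (simp add: psd_kernel_def)
  have z: "z = (\<Sum>i\<in>UNIV. \<Sum>j\<in>UNIV. cnj (x $ i) * x $ j * of_real (K i j))"
    by (simp add: z_def matrix_vector_mult_def sum_distrib_left mult_ac)
  have "Re z = (\<Sum>i\<in>UNIV. \<Sum>j\<in>UNIV. Re (x $ i) * Re (x $ j) * K i j)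
             + (\<Sum>i\<in>UNIV. \<Sum>j\<in>UNIV. Im (x $ i) * Im (x $ j) * K i j)"
    by (simp add: z algebra_simps flip: sum.distrib)
  also have "\<dots> \<ge> 0"
    using assms by (intro add_nonneg_nonneg) (simp_all add: psd_kernel_def)
  finally have re: "Re z \<ge> 0" .
  have "Im z = (\<Sum>i\<in>UNIV. \<Sum>j\<in>UNIV. Re (x $ i) * Im (x $ j) * K i j)
             - (\<Sum>i\<in>UNIV. \<Sum>j\<in>UNIV. Im (x $ i) * Re (x $ j) * K i j)"
    by (simp add: z algebra_simps flip: sum_subtractf)
  also have "(\<Sum>i\<in>UNIV. \<Sum>j\<in>UNIV. Im (x $ i) * Re (x $ j) * K i j)
           = (\<Sum>i\<in>UNIV. \<Sum>j\<in>UNIV. Re (x $ i) * Im (x $ j) * K i j)"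
    by (subst sum.swap) (simp add: sym mult_ac)
  finally have im: "Im z = 0" by simp
  from re im have "z \<in> \<real>\<^sub>\<ge>\<^sub>0"
    by (simp add: complex_nonneg_Reals_iff)
  then show "(\<Sum>i\<in>UNIV. cnj (x $ i) * ((\<chi> i j. complex_of_real (K i j)) *v x) $ i) \<in> \<real>\<^sub>\<ge>\<^sub>0"
    by (simp only: z_def)
qed

section \<open>Powers of the Cauchy kernel as multipliers\<close>

text \<open>
  The coefficient of \<open>t\<^sup>n\<close> in \<open>(1 - t)\<^sup>-\<^sup>r\<close> is \<open>pochhammer r n / fact n\<close>, which is positive.
\<close>

lemma psd_kernel_mult_binomial:
  assumes K: "psd_kernel K" and "0 < r" and u: "\<And>i. \<bar>u i\<bar> < 1"
  shows "psd_kernel (\<lambda>i j. (1 - u i * u j) powr (- r) * K i j)"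
proof (rule psd_kernel_limit)
  define c where "c n = pochhammer r n / fact n" for n
  show "psd_kernel (\<lambda>i j. \<Sum>n<N. c n * (u i ^ n * u j ^ n * K i j))" for N
    using \<open>0 < r\<close> by (intro psd_kernel_sum psd_kernel_scale psd_kernel_congruence K)
      (simp add: c_def pochhammer_pos less_imp_le)
  fix i j
  have "\<bar>u i\<bar> * \<bar>u j\<bar> < 1 * 1"
    by (intro mult_strict_mono' u) auto
  then have "\<bar>- (u i * u j)\<bar> < 1"
    by (simp add: abs_mult)
  then have "(\<lambda>n. (- r gchoose n) * (- (u i * u j)) ^ n) sums (1 + - (u i * u j)) powr (- r)"
    by (rule gen_binomial_real)
  moreover have "(- r gchoose n) * (- (u i * u j)) ^ n = c n * (u i ^ n * u j ^ n)" for n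
    by (simp add: gbinomial_pochhammer c_def power_mult_distrib power_minus[of "u i * u j"]
        flip: power_add mult_2_right)
  ultimately have "(\<lambda>n. c n * (u i ^ n * u j ^ n)) sums (1 - u i * u j) powr (- r)"
    by simp
  then have "(\<lambda>n. c n * (u i ^ n * u j ^ n) * K i j) sums ((1 - u i * u j) powr (- r) * K i j)"
    by (rule sums_mult2)
  then show "(\<lambda>N. \<Sum>n<N. c n * (u i ^ n * u j ^ n * K i j))
      \<longlonglongrightarrow> (1 - u i * u j) powr (- r) * K i j"
    by (simp add: sums_def mult_ac)
qed

text \<open>
  The binomial series converges only inside the unit disc, whereas the \<open>a i\<close> are arbitrary positive
  numbers. The Cayley transform moves them into \<open>(-1, 1)\<close>, at the cost of a diagonal congruence.
\<close>

lemma psd_kernel_mult_Cauchy_powr: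
  assumes K: "psd_kernel K" and r: "0 < r" and a: "\<And>i. 0 < a i"
  shows "psd_kernel (\<lambda>i j. (a i + a j) powr (- r) * K i j)"
proof -
  define u where "u i = (a i - 1) / (a i + 1)" for i
  have u: "\<bar>u i\<bar> < 1" for i
    using a[of i] by (simp add: u_def abs_less_iff field_simps)
  have "(a i + a j) powr (- r) * K i j = 2 powr r * ((a i + 1) powr (- r) * (a j + 1) powr (- r) *
      ((1 - u i * u j) powr (- r) * K i j))" for i j
  proof -
    have pos: "0 < a i + 1" "0 < a j + 1"
      using a[of i] a[of j] by auto
    have eq: "1 - u i * u j = (2 * (a i + a j)) / ((a i + 1) * (a j + 1))"
      using pos by (simp add: u_def divide_simps) (simp add: algebra_simps)
    have "(1 - u i * u j) powr (- r) =
        2 powr (- r) * (a i + a j) powr (- r) / ((a i + 1) powr (- r) * (a j + 1) powr (- r))"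
      unfolding eq using pos a[of i] a[of j]
      by (simp add: powr_divide powr_mult del: distrib_left_numeral)
    moreover have "(2::real) powr r * 2 powr (- r) = 1"
      by (simp flip: powr_add)
    ultimately show ?thesis
      using pos by simp
  qed
  moreover have "psd_kernel (\<lambda>i j. 2 powr r * ((a i + 1) powr (- r) * (a j + 1) powr (- r) *
      ((1 - u i * u j) powr (- r) * K i j)))"
    by (intro psd_kernel_scale psd_kernel_congruence psd_kernel_mult_binomial K r u) simp
  ultimately show ?thesis
    by (simp only:)
qed

section \<open>Powers of the Gamma kernel\<close>

text \<open>
  Each linear factor \<open>x\<^sub>i + x\<^sub>j + k\<close> becomes a Cauchy kernel once the shift \<open>k\<close> is divided equally
  between \<open>x\<^sub>i\<close> and \<open>x\<^sub>j\<close>.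
\<close>

lemma psd_kernel_pochhammer_powr:
  assumes r: "0 < r" and x: "\<And>i. 0 < x i"
  shows "psd_kernel (\<lambda>i j. pochhammer (x i + x j) n powr (- r))"
proof (induction n)
  case 0
  show ?case by (simp add: psd_kernel_const)
next
  case (Suc n)
  have "pochhammer (x i + x j) (Suc n) powr (- r) =
      ((x i + n / 2) + (x j + n / 2)) powr (- r) * pochhammer (x i + x j) n powr (- r)" for i j
  proof -
    have "0 < x i + x j" using x[of i] x[of j] by simp
    then have "0 < pochhammer (x i + x j) n" by (rule pochhammer_pos)
    with \<open>0 < x i + x j\<close> show ?thesis
      by (simp add: pochhammer_Suc powr_mult mult_ac add_ac)
  qed
  moreover have "psd_kernel (\<lambda>i j. ((x i + n / 2) + (x j + n / 2)) powr (- r) *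
      pochhammer (x i + x j) n powr (- r))"
    using x by (intro psd_kernel_mult_Cauchy_powr Suc r) (simp add: add_pos_nonneg)
  ultimately show ?case by simp
qed

lemma psd_kernel_Gamma_powr:
  assumes r: "0 < r" and x: "\<And>i. 0 < x i"
  shows "psd_kernel (\<lambda>i j. Gamma (x i + x j) powr r)"
proof (rule psd_kernel_limit)
  fix i j
  have "Gamma (x i + x j) > 0"
    using x[of i] x[of j] by (intro Gamma_real_pos) simp
  then show "(\<lambda>n. Gamma_series (x i + x j) n powr r) \<longlonglongrightarrow> Gamma (x i + x j) powr r"
    by (intro tendsto_powr Gamma_series_LIMSEQ tendsto_const) simp
next
  fix n :: nat
  \<comment> \<open>The \<open>r\<close>-th power of the factor \<open>n\<^sup>x\<close> of Gauss's formula, as an exponential; with \<open>ln 0 = 0\<close> it is positive for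
    \<open>n = 0\<close> too.\<close>
  define d where "d i = exp (x i * ln (real n)) powr r" for i
  have "Gamma_series (x i + x j) n powr r =
      fact n powr r * (d i * d j * pochhammer (x i + x j) (Suc n) powr (- r))" for i j
  proof -
    have "0 < x i + x j" using x[of i] x[of j] by simp
    then have "0 < pochhammer (x i + x j) (Suc n)" by (rule pochhammer_pos)
    then show ?thesis
      by (simp add: Gamma_series_def d_def powr_divide powr_mult powr_minus distrib_right
          exp_add field_simps)
  qed
  moreover have "psd_kernel (\<lambda>i j. fact n powr r *
      (d i * d j * pochhammer (x i + x j) (Suc n) powr (- r)))"
    by (intro psd_kernel_scale psd_kernel_congruence psd_kernel_pochhammer_powr r x) simp
  ultimately show "psd_kernel (\<lambda>i j. Gamma_series (x i + x j) n powr r)"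
    by simp
qed

theorem mainTheorem7:
  fixes l :: "real ^ 'n"
  assumes "\<And>i. l $ i > 0"
  shows "infinitely_divisible (\<chi> i j. 1 / Beta (l $ i) (l $ j))"
proof -
  have pos: "0 < Gamma (l $ i)" "0 < Gamma (l $ i + l $ j)" for i j
    using assms[of i] assms[of j] by (auto intro: Gamma_real_pos)
  have "0 \<le> 1 / Beta (l $ i) (l $ j)" for i j
    using pos(1)[of i] pos(1)[of j] pos(2)[of i j] by (simp add: Beta_def)
  moreover have "positive_semidefinite
      (\<chi> i j. complex_of_real ((1 / Beta (l $ i) (l $ j)) powr r))" if "0 < r" for r
  proof (rule psd_kernel_imp_positive_semidefinite)
    have "(1 / Beta (l $ i) (l $ j)) powr r = Gamma (l $ i) powr (- r) * Gamma (l $ j) powr (- r) *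
        Gamma (l $ i + l $ j) powr r" for i j
    proof -
      have "1 / Beta (l $ i) (l $ j) = Gamma (l $ i + l $ j) / (Gamma (l $ i) * Gamma (l $ j))"
        by (simp add: Beta_def)
      show ?thesis
        unfolding \<open>1 / Beta (l $ i) (l $ j) = _\<close>
        using pos(1)[of i] pos(1)[of j] pos(2)[of i j]
        by (simp add: powr_divide powr_mult powr_minus divide_simps)
    qed
    moreover have "psd_kernel (\<lambda>i j. Gamma (l $ i) powr (- r) * Gamma (l $ j) powr (- r) *
        Gamma (l $ i + l $ j) powr r)"
      by (intro psd_kernel_congruence psd_kernel_Gamma_powr that assms)
    ultimately show "psd_kernel (\<lambda>i j. (1 / Beta (l $ i) (l $ j)) powr r)"
      by simp
  qed
  ultimately show ?thesis
    by (simp add: infinitely_divisible_def entrywise_power_def)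
qed

end
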